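(* Let $P\in\mathbb{H}[X]$ be a polynomial of degree $2$. Then $V(N(P))=\mathbb{S}_{x_1}\cup\mathbb{S}_{x_2}$ for some $x_1,x_2\in\mathbb{H}$ (possibly with $\mathbb{S}_{x_1}=\mathbb{S}_{x_2}$) and $$V(P')\subset\bigcup_{y_1\in\mathbb{S}_{x_1},\,y_2\in\mathbb{S}_{x_2}}\left\{\frac{y_1+y_2}{2}\right\}.$$ In particular, every polynomial $P\in\mathbb{H}[X]$ of degree $2$ is a Gauss-Lucas polynomial.
   Context: $\mathbb{H}$ denotes the real algebra of quaternions and $\mathbb{H}^*=\mathbb{H}\setminus\{0\}$. $\mathbb{H}[X]$ is the ring of quaternionic polynomials $P(X)=\sum_{k=0}^d X^k a_k$ with coefficients $a_k\in\mathbb{H}$ written on the right; the product $P\cdot Q$ is defined by letting $X$ commute with the coefficients, i.e. $(\sum_h X^h a_h)\cdot(\sum_k X^k b_k)=\sum_{h,k}X^{h+k}a_hb_k$. The value of $P$ at $x\in\mathbb{H}$ is $P(x)=\sum_{k=0}^d x^k a_k$, and $V(P)=\{x\in\mathbb{H}\mid P(x)=0\}$. The derivative is $P'(X)=\sum_{k=1}^d X^{k-1}k a_k$. Set $P^c(X)=\sum_{k=0}^d X^k\bar a_k$ (quaternionic conjugates of the coefficients) and $N(P)=P\cdot P^c=P^c\cdot P$, the normal polynomial of $P$, which has real coefficients. For $x\in\mathbb{H}$, $\mathbb{S}_x=\{pxp^{-1}\mid p\in\mathbb{H}^*\}$. Let $\mathcal{K}(N(P))$ denote the convex hull in $\mathbb{H}\cong\mathbb{R}^4$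 of $V(N(P))\subset\mathbb{H}$. A polynomial $P\in\mathbb{H}[X]$ of degree $\ge 2$ is called a Gauss-Lucas polynomial if $V(P')\subset\mathcal{K}(N(P))$. *)

theory Defs
  imports "HOL-Analysis.Convex" "HOL-Computational_Algebra.Polynomial"
begin

datatype quat = Quat (qRe: real) (qI: real) (qJ: real) (qK: real)

lemma quat_eq_iff:
  "x = y \<longleftrightarrow> qRe x = qRe y \<and> qI x = qI y \<and> qJ x = qJ y \<and> qK x = qK y"
  by (cases x; cases y) simp

instantiation quat :: ab_group_add
begin

definition "0 = Quat 0 0 0 0"
definition "x + y = Quat (qRe x + qRe y) (qI x + qI y) (qJ x + qJ y) (qK x + qK y)"
definition "- x = Quat (- qRe x) (- qI x) (- qJ x) (- qK x)"
definition "x - y = Quat (qRe x - qRe y) (qI x - qI y) (qJ x - qJ y) (qK x - qK y)"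

lemma quat_zero_sel [simp]: "qRe 0 = 0" "qI 0 = 0" "qJ 0 = 0" "qK 0 = 0"
  by (simp_all only: zero_quat_def quat.sel)

lemma quat_plus_sel [simp]:
  "qRe (x + y) = qRe x + qRe y" "qI (x + y) = qI x + qI y"
  "qJ (x + y) = qJ x + qJ y" "qK (x + y) = qK x + qK y"
  by (simp_all only: plus_quat_def quat.sel)

lemma quat_uminus_sel [simp]:
  "qRe (- x) = - qRe x" "qI (- x) = - qI x" "qJ (- x) = - qJ x" "qK (- x) = - qK x"
  by (simp_all only: uminus_quat_def quat.sel)

lemma quat_minus_sel [simp]:
  "qRe (x - y) = qRe x - qRe y" "qI (x - y) = qI x - qI y"
  "qJ (x - y) = qJ x - qJ y" "qK (x - y) = qK x - qK y"
  by (simp_all only: minus_quat_def quat.sel)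

instance
  by standard (simp_all add: quat_eq_iff)

end

instantiation quat :: real_vector
begin

definition "r *\<^sub>R x = Quat (r * qRe x) (r * qI x) (r * qJ x) (r * qK x)"

lemma quat_scaleR_sel [simp]:
  "qRe (r *\<^sub>R x) = r * qRe x" "qI (r *\<^sub>R x) = r * qI x"
  "qJ (r *\<^sub>R x) = r * qJ x" "qK (r *\<^sub>R x) = r * qK x"
  by (simp_all only: scaleR_quat_def quat.sel)

instance
  by standard (simp_all add: quat_eq_iff distrib_left distrib_right)

end

instantiation quat :: real_algebra_1
begin

definition "1 = Quat 1 0 0 0"

definition "x * y = Quat
  (qRe x * qRe y - qI x * qI y - qJ x * qJ y - qK x * qK y)
  (qRe x * qI y + qI x * qRe y + qJ x * qK y - qK x * qJ y)
  (qRe x * qJ y - qI x * qK y + qJ x * qRe y + qK x * qI y)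
  (qRe x * qK y + qI x * qJ y - qJ x * qI y + qK x * qRe y)"

lemma quat_one_sel [simp]: "qRe 1 = 1" "qI 1 = 0" "qJ 1 = 0" "qK 1 = 0"
  by (simp_all only: one_quat_def quat.sel)

lemma quat_times_sel [simp]:
  "qRe (x * y) = qRe x * qRe y - qI x * qI y - qJ x * qJ y - qK x * qK y"
  "qI (x * y) = qRe x * qI y + qI x * qRe y + qJ x * qK y - qK x * qJ y"
  "qJ (x * y) = qRe x * qJ y - qI x * qK y + qJ x * qRe y + qK x * qI y"
  "qK (x * y) = qRe x * qK y + qI x * qJ y - qJ x * qI y + qK x * qRe y"
  by (simp_all only: times_quat_def quat.sel)

instance
  by standard (simp_all add: quat_eq_iff algebra_simps)

end

definition quat_cnj :: "quat \<Rightarrow> quat" where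
  "quat_cnj x = Quat (qRe x) (- qI x) (- qJ x) (- qK x)"

lemma quat_cnj_sel [simp]:
  "qRe (quat_cnj x) = qRe x" "qI (quat_cnj x) = - qI x"
  "qJ (quat_cnj x) = - qJ x" "qK (quat_cnj x) = - qK x"
  by (simp_all only: quat_cnj_def quat.sel)

definition quat_norm2 :: "quat \<Rightarrow> real" where
  "quat_norm2 x = (qRe x)\<^sup>2 + (qI x)\<^sup>2 + (qJ x)\<^sup>2 + (qK x)\<^sup>2"

lemma quat_norm2_eq_0_iff: "quat_norm2 x = 0 \<longleftrightarrow> x = 0"
  by (auto simp: quat_norm2_def quat_eq_iff add_nonneg_eq_0_iff)

lemma quat_mult_cnj: "x * quat_cnj x = quat_norm2 x *\<^sub>R 1"
  and quat_cnj_mult: "quat_cnj x * x = quat_norm2 x *\<^sub>R 1"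
  by (simp_all add: quat_eq_iff quat_norm2_def power2_eq_square)

instantiation quat :: real_div_algebra
begin

definition "inverse x = (1 / quat_norm2 x) *\<^sub>R quat_cnj x"
definition "x div y = x * inverse (y :: quat)"

instance
proof
  fix x y :: quat
  assume "x \<noteq> 0"
  then have "quat_norm2 x \<noteq> 0"
    by (simp add: quat_norm2_eq_0_iff)
  then show "inverse x * x = 1" "x * inverse x = 1"
    by (simp_all only: inverse_quat_def mult_scaleR_left mult_scaleR_right quat_mult_cnj
        quat_cnj_mult scaleR_scaleR) simp_all
next
  show "x div y = x * inverse y" for x y :: quat
    by (fact divide_quat_def)
  show "inverse (0 :: quat) = 0"
    by (simp add: inverse_quat_def quat_eq_iff)
qed

end

text \<open>
  A value of type \<^typ>\<open>quat poly\<close> stands for the polynomial whose right coefficient of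
  $X^k$ is \<^term>\<open>coeff P k\<close>. The library's evaluation, product and derivative assume
  commutative coefficients, so they are defined here for quaternions.
\<close>

definition qpoly_eval :: "quat poly \<Rightarrow> quat \<Rightarrow> quat" where
  "qpoly_eval P x = (\<Sum>k\<le>degree P. x ^ k * coeff P k)"

definition qpoly_zeros :: "quat poly \<Rightarrow> quat set" where
  "qpoly_zeros P = {x. qpoly_eval P x = 0}"

definition qpoly_mult :: "quat poly \<Rightarrow> quat poly \<Rightarrow> quat poly" where
  "qpoly_mult P Q = (\<Sum>h\<le>degree P. \<Sum>k\<le>degree Q. monom (coeff P h * coeff Q k) (h + k))"

definition qpoly_deriv :: "quat poly \<Rightarrow> quat poly" where
  "qpoly_deriv P = (\<Sum>k=1..degree P. monom (of_nat k * coeff P k) (k - 1))"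

definition qpoly_cnj :: "quat poly \<Rightarrow> quat poly" where
  "qpoly_cnj P = map_poly quat_cnj P"

definition normal_poly :: "quat poly \<Rightarrow> quat poly" where
  "normal_poly P = qpoly_mult P (qpoly_cnj P)"

definition quat_sphere :: "quat \<Rightarrow> quat set" where
  "quat_sphere x = {p * x * inverse p | p. p \<noteq> 0}"

definition gauss_lucas_poly :: "quat poly \<Rightarrow> bool" where
  "gauss_lucas_poly P \<longleftrightarrow>
    degree P \<ge> 2 \<and> qpoly_zeros (qpoly_deriv P) \<subseteq> convex hull qpoly_zeros (normal_poly P)"

end

theory Submission
  imports Defs "HOL-Computational_Algebra.Fundamental_Theorem_Algebra"
begin

text \<open>
  If $z$ is a root of the real polynomial $N(Q)$ of a monic quadratic $Q$, then either $z$ is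
  real and already a root of $Q$, or dividing $Q$ by the real quadratic $q$ of $z$ leaves a linear
  remainder whose normal polynomial is a multiple of $q$, so that the root of the remainder is also
  a root of $Q$. Hence $P = (X - x_1)\cdot(X - x_2)\cdot a_2$, which makes $N(P)$ a multiple of the
  product of the characteristic polynomials of $x_1$ and $x_2$, and makes $(x_1 + x_2)/2$ the only
  zero of $P'$.
\<close>

section \<open>Conjugacy classes as zero sets of real quadratics\<close>

lemma quat_cnj_times: "quat_cnj (x * y) = quat_cnj y * quat_cnj x"
  by (simp add: quat_eq_iff algebra_simps)

lemma quat_norm2_times: "quat_norm2 (x * y) = quat_norm2 x * quat_norm2 y"
  by (simp add: quat_norm2_def power2_eq_square algebra_simps)

text \<open>The value at \<open>x\<close> of (X - y)(X - cnj y), which has real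
  coefficients.\<close>

definition quat_charpoly :: "quat \<Rightarrow> quat \<Rightarrow> quat" where
  "quat_charpoly y x = x * x - (2 * qRe y) *\<^sub>R x + quat_norm2 y *\<^sub>R 1"

lemma quat_charpoly_self: "quat_charpoly x x = 0"
  by (simp add: quat_charpoly_def quat_eq_iff quat_norm2_def power2_eq_square algebra_simps)

lemma quat_sphere_self: "x \<in> quat_sphere x"
  unfolding quat_sphere_def by (auto intro!: exI[of _ 1])

text \<open>Conjugation by \<open>p\<close> is a real algebra automorphism, so it maps zeros of a
  real polynomial to zeros; \<open>y\<close> is one by \<open>quat_charpoly_self\<close>.\<close>

lemma quat_charpoly_conj:
  assumes "p \<noteq> 0"
  shows "quat_charpoly y (p * y * inverse p) = 0"
proof -
  let ?x = "p * y * inverse p"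
  have xp: "?x * p = p * y"
    using assms by (simp add: mult.assoc)
  then have "?x * ?x * p = p * (y * y)"
    by (metis mult.assoc)
  then have "quat_charpoly y ?x * p = p * quat_charpoly y y"
    unfolding quat_charpoly_def distrib_right left_diff_distrib mult_scaleR_left xp
    by (simp add: distrib_left right_diff_distrib)
  then show ?thesis
    using assms by (simp add: quat_charpoly_self)
qed

text \<open>Since \<open>quat_cnj y + y\<close> and \<open>quat_cnj y * y\<close> are real, the two
  sides differ by \<open>quat_charpoly y x * u\<close>. Any \<open>u\<close> that makes the bracket
  nonzero thus yields a \<open>p\<close> conjugating \<open>y\<close> to \<open>x\<close>.\<close>

lemma quat_charpoly_intertwine:
  assumes "quat_charpoly y x = 0"
  shows "x * (x * u - u * quat_cnj y) = (x * u - u * quat_cnj y) * y"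
proof -
  have trace: "quat_cnj y + y = (2 * qRe y) *\<^sub>R 1"
    by (simp add: quat_eq_iff)
  have "x * (x * u - u * quat_cnj y) - (x * u - u * quat_cnj y) * y
      = x * x * u - x * u * (quat_cnj y + y) + u * (quat_cnj y * y)"
    by (simp add: algebra_simps)
  also have "\<dots> = quat_charpoly y x * u"
    by (simp add: quat_cnj_mult trace quat_charpoly_def left_diff_distrib distrib_right)
  finally show ?thesis using assms by simp
qed

lemma quat_charpoly_eq_0_iff: "quat_charpoly y x = 0 \<longleftrightarrow> x \<in> quat_sphere y"
proof
  assume 0: "quat_charpoly y x = 0"
  show "x \<in> quat_sphere y"
  proof (cases "\<exists>u. x * u - u * quat_cnj y \<noteq> 0")
    case True
    then obtain u where u: "x * u - u * quat_cnj y \<noteq> 0" by blast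
    define p where "p = x * u - u * quat_cnj y"
    have "p \<noteq> 0" "x * p = p * y"
      using u quat_charpoly_intertwine[OF 0] by (simp_all add: p_def)
    then have "x = p * y * inverse p"
      by (metis mult.assoc mult_1_right right_inverse)
    with \<open>p \<noteq> 0\<close> show ?thesis by (auto simp: quat_sphere_def)
  next
    case False
    \<comment> \<open>then \<open>x = quat_cnj y\<close> is central, hence real\<close>
    then have eq: "x * u = u * quat_cnj y" for u by simp
    from eq[of 1] eq[of "Quat 0 1 0 0"] eq[of "Quat 0 0 1 0"] have "x = y"
      by (simp add: quat_eq_iff)
    then show ?thesis by (simp add: quat_sphere_self)
  qed
next
  assume "x \<in> quat_sphere y"
  then show "quat_charpoly y x = 0"
    by (auto simp: quat_sphere_def quat_charpoly_conj)
qed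

section \<open>Roots and factorization of quadratics\<close>

lemma quat_monic_quadratic_root:
  fixes b c :: quat
  shows "\<exists>x. x * x + x * b + c = 0"
proof -
  \<comment> \<open>These are the lower coefficients of N(Q) for Q = X^2 + X b + c. They are real,
    so N(Q) has a complex root \<open>z\<close>.\<close>
  define B C D E where "B = 2 * qRe b" and "C = 2 * qRe c + quat_norm2 b"
    and "D = 2 * qRe (b * quat_cnj c)" and "E = quat_norm2 c"
  have "\<not> constant (poly [:complex_of_real E, of_real D, of_real C, of_real B, 1:])"
    by (simp add: constant_degree)
  then obtain z where "poly [:complex_of_real E, of_real D, of_real C, of_real B, 1:] z = 0"
    using fundamental_theorem_of_algebra by blast
  then have z: "E + z * (D + z * (C + z * (B + z))) = 0"
    by simp
  obtain r s where rs: "z = Complex r s" by (cases z)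
  show ?thesis
  proof (cases "s = 0")
    case True
    have "E + r * (D + r * (C + r * (B + r))) = 0"
      using arg_cong[OF z, of Re] by (simp add: rs True)
    \<comment> \<open>A real \<open>r\<close> commutes with all coefficients, so N(Q)(r) is the
      squared norm of Q(r).\<close>
    also have "E + r * (D + r * (C + r * (B + r)))
        = quat_norm2 (of_real r * of_real r + of_real r * b + c)"
      by (simp add: B_def C_def D_def E_def quat_norm2_def of_real_def power2_eq_square algebra_simps)
    finally show ?thesis
      by (auto simp: quat_norm2_eq_0_iff)
  next
    case False
    \<comment> \<open>Let q = X^2 - 2rX + n, the real quadratic with root \<open>z\<close>. Then Q =
      q + R with R = X d + e, and F X^2 + G X + H is N(R).\<close>
    define n where "n = r\<^sup>2 + s\<^sup>2"
    define d e where "d = b + (2 * r) *\<^sub>R 1" and "e = c - n *\<^sub>R 1"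
    define F G H where "F = quat_norm2 d" and "G = 2 * qRe (d * quat_cnj e)"
      and "H = quat_norm2 e"
    have q: "z * z = 2 * r * z - n"
      by (simp add: rs n_def complex_eq_iff power2_eq_square)
    have coeffs: "B = 2 * qRe d - 4 * r" "C = 2 * qRe e + 2 * n + F - 4 * r * qRe d + 4 * r\<^sup>2"
      "D = G + 2 * n * qRe d - 4 * r * qRe e - 4 * r * n" "E = H + 2 * n * qRe e + n\<^sup>2"
      by (simp_all add: B_def C_def D_def E_def F_def G_def H_def d_def e_def quat_norm2_def
          power2_eq_square algebra_simps)
    \<comment> \<open>This is N(q + R) = q (q + R + R^c) + N(R) evaluated at \<open>z\<close>, where
      q vanishes.\<close>
    have "E + z * (D + z * (C + z * (B + z)))
        = (z * z - 2 * r * z + n) * (z * z - 2 * r * z + n + 2 * qRe d * z + 2 * qRe e)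
          + (F * (z * z) + G * z + H)"
      by (simp add: coeffs power2_eq_square algebra_simps)
    with z have "F * (z * z) + G * z + H = 0"
      by (simp add: q)
    then have R: "(F * (2 * r) + G) * z + (H - F * n) = 0"
      by (simp add: q algebra_simps)
    \<comment> \<open>A real linear polynomial vanishing at the non-real \<open>z\<close> is zero;
      hence N(R) = F q.\<close>
    have "(F * (2 * r) + G) * s = 0"
      using arg_cong[OF R, of Im] by (simp add: rs)
    then have G: "G = - 2 * r * F"
      using False by (simp add: eq_neg_iff_add_eq_0 add.commute mult.commute)
    have H: "H = F * n"
      using arg_cong[OF R, of Re] by (simp add: rs G)
    show ?thesis
    proof (cases "d = 0")
      case True
      then have "e = 0"
        using H by (simp add: F_def H_def quat_norm2_def flip: quat_norm2_eq_0_iff)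
      \<comment> \<open>Here R = 0, so Q = q, and the witness is \<open>z\<close> embedded in the
        quaternions.\<close>
      let ?x = "Quat r s 0 0"
      have "b = (- 2 * r) *\<^sub>R 1" "c = n *\<^sub>R 1"
        using True \<open>e = 0\<close> by (simp_all add: d_def e_def eq_neg_iff_add_eq_0)
      then have "?x * ?x + ?x * b + c = 0"
        by (simp add: quat_eq_iff n_def power2_eq_square)
      then show ?thesis ..
    next
      case False
      \<comment> \<open>This is the root of R. By N(R) = F q it has real part \<open>r\<close> and
        squared norm \<open>n\<close>, so q is its own characteristic polynomial and vanishes at it
        too.\<close>
      define x where "x = - (e * inverse d)"
      have F: "F \<noteq> 0" using False by (simp add: F_def quat_norm2_eq_0_iff)
      have xd: "x * d = - e"
        using False by (simp add: x_def mult.assoc)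
      have "qRe x = - (G / (2 * F))"
        by (simp add: x_def inverse_quat_def F_def G_def divide_simps algebra_simps)
      then have re: "qRe x = r" using G F by simp
      have "quat_norm2 x * F = quat_norm2 (x * d)"
        by (simp add: quat_norm2_times F_def)
      also have "\<dots> = H" by (simp add: xd H_def quat_norm2_def)
      finally have norm: "quat_norm2 x = n" using H F by simp
      have "x * x + x * b + c = quat_charpoly x x + x * d + e"
        by (simp add: quat_charpoly_def re norm d_def e_def algebra_simps)
      also have "\<dots> = 0" by (simp add: quat_charpoly_self xd)
      finally show ?thesis ..
    qed
  qed
qed

text \<open>The equations compare coefficients with (X - x1)(X - x2) a2. A root \<open>x1\<close> of
  the quadratic made monic gives c = - x1 (x1 + b), so the choice \<open>x2 = - b - x1\<close>
  matches both.\<close>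

lemma quat_quadratic_factorization:
  fixes a0 a1 a2 :: quat
  assumes "a2 \<noteq> 0"
  obtains x1 x2 where "a1 = - (x1 + x2) * a2" "a0 = x1 * x2 * a2"
proof -
  define b c where "b = a1 / a2" and "c = a0 / a2"
  obtain x1 where x1: "x1 * x1 + x1 * b + c = 0"
    using quat_monic_quadratic_root by blast
  define x2 where "x2 = - b - x1"
  have "b = - (x1 + x2)" by (simp add: x2_def)
  moreover have "c = x1 * x2"
    using x1 by (simp add: x2_def algebra_simps eq_neg_iff_add_eq_0)
  moreover have "a1 = b * a2" "a0 = c * a2"
    using assms by (simp_all add: b_def c_def divide_inverse mult.assoc)
  ultimately show ?thesis using that by metis
qed

section \<open>Values of the normal polynomial\<close>

lemma qpoly_eval_bound:
  assumes "degree P \<le> n"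
  shows "qpoly_eval P x = (\<Sum>k\<le>n. x ^ k * coeff P k)"
  unfolding qpoly_eval_def using assms
  by (intro sum.mono_neutral_left) (auto simp: coeff_eq_0 not_le)

lemma qpoly_eval_add: "qpoly_eval (P + Q) x = qpoly_eval P x + qpoly_eval Q x"
proof -
  let ?n = "max (degree P) (degree Q)"
  have "degree (P + Q) \<le> ?n" by (rule degree_add_le_max)
  then show ?thesis
    by (simp add: qpoly_eval_bound[of _ ?n] sum.distrib distrib_left)
qed

lemma qpoly_eval_sum: "qpoly_eval (\<Sum>i\<in>A. f i) x = (\<Sum>i\<in>A. qpoly_eval (f i) x)"
proof (induction A rule: infinite_finite_induct)
  case (insert i A)
  then show ?case by (simp add: qpoly_eval_add)
qed (simp_all add: qpoly_eval_def)

lemma qpoly_eval_monom: "qpoly_eval (monom a n) x = x ^ n * a"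
proof -
  have "qpoly_eval (monom a n) x = (\<Sum>k\<le>n. if k = n then x ^ k * a else 0)"
    unfolding qpoly_eval_bound[OF degree_monom_le] by (intro sum.cong) auto
  then show ?thesis by simp
qed

text \<open>Evaluation is additive but not multiplicative, so the product is expanded into
  monomials. Conjugation kills no nonzero coefficient, so both sums end at
  \<open>degree P\<close>.\<close>

lemma qpoly_eval_normal_poly:
  "qpoly_eval (normal_poly P) x =
    (\<Sum>h\<le>degree P. \<Sum>k\<le>degree P. x ^ (h + k) * (coeff P h * quat_cnj (coeff P k)))"
proof -
  have "quat_cnj 0 = 0" and "quat_cnj a = 0 \<longleftrightarrow> a = 0" for a
    by (simp_all add: quat_eq_iff)
  moreover from this have "degree (qpoly_cnj P) = degree P"
    unfolding qpoly_cnj_def by (intro degree_map_poly) auto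
  ultimately show ?thesis
    by (simp add: normal_poly_def qpoly_mult_def qpoly_eval_sum qpoly_eval_monom)
      (simp add: qpoly_cnj_def coeff_map_poly)
qed

text \<open>The real factor \<open>coeff P 2 * quat_cnj (coeff P 2)\<close> is central and can be
  pulled out. What remains is the normal polynomial of (X - x1)(X - x2), the product of two real
  quadratics.\<close>

lemma qpoly_eval_normal_quadratic:
  assumes "degree P = 2"
    and a1: "coeff P 1 = - (x1 + x2) * coeff P 2" and a0: "coeff P 0 = x1 * x2 * coeff P 2"
  shows "qpoly_eval (normal_poly P) x =
    quat_norm2 (coeff P 2) *\<^sub>R (quat_charpoly x1 x * quat_charpoly x2 x)"
proof -
  let ?m = "quat_norm2 (coeff P 2)"
  \<comment> \<open>The coefficients of (X - x1)(X - x2).\<close>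
  define f :: "nat \<Rightarrow> quat" where "f k = (if k = 0 then x1 * x2 else if k = 1 then - (x1 + x2) else 1)" for k
  have f: "coeff P k = f k * coeff P 2" if "k \<le> 2" for k
  proof -
    from that have "k = 0 \<or> k = 1 \<or> k = 2" by auto
    then show ?thesis using a0 a1 by (auto simp: f_def)
  qed
  have "coeff P h * quat_cnj (coeff P k) = ?m *\<^sub>R (f h * quat_cnj (f k))" if "h \<le> 2" "k \<le> 2" for h k
  proof -
    have "coeff P h * quat_cnj (coeff P k)
        = f h * (coeff P 2 * quat_cnj (coeff P 2)) * quat_cnj (f k)"
      using that by (simp add: f[of h] f[of k] quat_cnj_times mult.assoc)
    then show ?thesis by (simp add: quat_mult_cnj)
  qed
  then have "qpoly_eval (normal_poly P) x
      = ?m *\<^sub>R (\<Sum>h\<le>2. \<Sum>k\<le>2. x ^ (h + k) * (f h * quat_cnj (f k)))"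
    by (simp add: qpoly_eval_normal_poly assms(1) scaleR_sum_right)
  \<comment> \<open>Grouped by powers of \<open>x\<close>, each coefficient turns out to be real and
    agrees with that of the product of the two characteristic polynomials.\<close>
  also have "(\<Sum>h\<le>2. \<Sum>k\<le>2. x ^ (h + k) * (f h * quat_cnj (f k)))
      = f 0 * quat_cnj (f 0) + x * (f 0 * quat_cnj (f 1) + f 1 * quat_cnj (f 0))
        + x ^ 2 * (f 0 * quat_cnj (f 2) + f 1 * quat_cnj (f 1) + f 2 * quat_cnj (f 0))
        + x ^ 3 * (f 1 * quat_cnj (f 2) + f 2 * quat_cnj (f 1)) + x ^ 4 * (f 2 * quat_cnj (f 2))"
    by (simp add: numeral_eq_Suc atMost_Suc algebra_simps)
  also have "f 0 * quat_cnj (f 0) = (quat_norm2 x1 * quat_norm2 x2) *\<^sub>R 1"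
    by (simp add: f_def quat_mult_cnj quat_norm2_times)
  also have "f 0 * quat_cnj (f 1) + f 1 * quat_cnj (f 0)
      = (- 2 * (qRe x1 * quat_norm2 x2 + qRe x2 * quat_norm2 x1)) *\<^sub>R 1"
    by (simp add: f_def quat_eq_iff quat_norm2_def power2_eq_square algebra_simps)
  also have "f 0 * quat_cnj (f 2) + f 1 * quat_cnj (f 1) + f 2 * quat_cnj (f 0)
      = (quat_norm2 x1 + quat_norm2 x2 + 4 * qRe x1 * qRe x2) *\<^sub>R 1"
    by (simp add: f_def quat_eq_iff quat_norm2_def power2_eq_square algebra_simps)
  also have "f 1 * quat_cnj (f 2) + f 2 * quat_cnj (f 1) = (- 2 * (qRe x1 + qRe x2)) *\<^sub>R 1"
    by (simp add: f_def quat_eq_iff)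
  also have "f 2 * quat_cnj (f 2) = 1"
    by (simp add: f_def quat_eq_iff)
  finally show ?thesis
    by (simp add: quat_charpoly_def numeral_eq_Suc algebra_simps)
qed

section \<open>Locating the zero of the derivative\<close>

theorem proposition2:
  fixes P :: "quat poly"
  assumes "degree P = 2"
  shows "(\<exists>x1 x2. qpoly_zeros (normal_poly P) = quat_sphere x1 \<union> quat_sphere x2 \<and>
            qpoly_zeros (qpoly_deriv P) \<subseteq>
              (\<Union>y1\<in>quat_sphere x1. \<Union>y2\<in>quat_sphere x2. {(y1 + y2) / 2})) \<and>
         gauss_lucas_poly P"
proof -
  have a2: "coeff P 2 \<noteq> 0"
    using assms by (metis degree_0 leading_coeff_0_iff zero_neq_numeral)
  then obtain x1 x2 where a1: "coeff P 1 = - (x1 + x2) * coeff P 2"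
    and a0: "coeff P 0 = x1 * x2 * coeff P 2"
    by (rule quat_quadratic_factorization)
  \<comment> \<open>There are no zero divisors, so one of the two characteristic polynomials must
    vanish.\<close>
  have zeros: "qpoly_zeros (normal_poly P) = quat_sphere x1 \<union> quat_sphere x2"
    using a2 by (auto simp: qpoly_zeros_def qpoly_eval_normal_quadratic[OF assms a1 a0]
        quat_norm2_eq_0_iff quat_charpoly_eq_0_iff)
  have deriv: "x = (x1 + x2) / 2" if "x \<in> qpoly_zeros (qpoly_deriv P)" for x
  proof -
    have "{1..2} = {1, 2 :: nat}" by auto
    then have "coeff P 1 + x * (2 * coeff P 2) = 0"
      using that by (simp add: qpoly_zeros_def qpoly_deriv_def assms qpoly_eval_sum qpoly_eval_monom
          qpoly_eval_add)
    then have "(x * 2 - (x1 + x2)) * coeff P 2 = 0"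
      by (simp add: a1[simplified] algebra_simps)
    then show ?thesis using a2 by (simp add: nonzero_eq_divide_eq)
  qed
  \<comment> \<open>Quaternionic division by 2 is rewritten as a real convex combination of two
    zeros of N(P).\<close>
  have "(x1 + x2) / 2 = (1 / 2) *\<^sub>R x1 + (1 / 2) *\<^sub>R x2"
  proof -
    have "((1 / 2) *\<^sub>R x1 + (1 / 2) *\<^sub>R x2) * 2 = x1 + x2"
      by (simp add: mult_2_right flip: scaleR_add_left add: algebra_simps)
    then show ?thesis by (simp add: nonzero_divide_eq_eq)
  qed
  also have "\<dots> \<in> convex hull qpoly_zeros (normal_poly P)"
    by (intro convexD[OF convex_convex_hull] hull_inc) (simp_all add: zeros quat_sphere_self)
  finally have "qpoly_zeros (qpoly_deriv P) \<subseteq> convex hull qpoly_zeros (normal_poly P)"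
    using deriv by (metis subsetI)
  then have "gauss_lucas_poly P"
    by (simp add: gauss_lucas_poly_def assms)
  \<comment> \<open>The points \<open>y1 = x1\<close> and \<open>y2 = x2\<close> of the two spheres
    suffice.\<close>
  moreover have "qpoly_zeros (qpoly_deriv P) \<subseteq>
      (\<Union>y1\<in>quat_sphere x1. \<Union>y2\<in>quat_sphere x2. {(y1 + y2) / 2})"
    using deriv quat_sphere_self by blast
  ultimately show ?thesis using zeros by blast
qed

end
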